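(* Let $q$ be an odd prime power, $\beta\in\mathbb{F}_q^*$, and let $\theta_1,\theta_2\in\mathbb{F}_{q^2}$ form an $\mathbb{F}_q$-basis of $\mathbb{F}_{q^2}$ with $\mathrm{Tr}(\theta_1)=\beta$, $\mathrm{Tr}(\theta_2)=0$. Let $q_2'$ be the product of the distinct odd primes dividing $q^2-1$ and write $q_2'=k\,p_1\cdots p_s$ with $p_1,\dots,p_s$ distinct primes (not dividing $k$), ordered so that $p_i\mid q+1$ for $1\le i\le r$ and $p_i\nmid q+1$ for $r<i\le s$. Let $\varepsilon=1-\sum_{i=1}^s1/p_i$ ($\varepsilon=1$ if $s=0$), $\varepsilon'=1-\sum_{i=1}^r1/p_i$, and let $k_1$ be the largest divisor of $k$ dividing $q+1$. Assume $\varepsilon>0$. (1) If $q\equiv1\pmod4$ and $q+1>4\Big[W(k)\big(\frac{s-1}{\varepsilon}+2\big)\sqrt q-W(k_1)\big(\frac{r-1+\varepsilon'}{\varepsilon}+1\big)\frac{\sqrt q-1}{2}\Big]$, then $\mathcal{Q}_{q_2'}\ne0$. (2) If $q\equiv3\pmod4$ and $q+1>4\Big[W(k)\big(\frac{s-1}{\varepsilon}+2\big)\sqrt q-W(k_1)\big(\frac{r-1+\varepsilon'}{\varepsilon}+1\big)(\sqrt q-1)\Big]$, then $\mathcal{Q}_{q_2'}\ne0$.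
   Context: $\mathrm{Tr}(x)=x+x^q$ for $x\in\mathbb{F}_{q^2}$. For $t\mid q^2-1$, $\xi\in\mathbb{F}_{q^2}^*$ is $t$-free if $\xi=\zeta^d$ with $d\mid t$, $\zeta\in\mathbb{F}_{q^2}^*$ implies $d=1$. For $t\mid q_2'$, $\mathcal{Q}_t$ is the number of $\alpha\in\mathbb{F}_q$ such that $\theta_1+\alpha\theta_2$ is $t$-free and is a square but not a fourth power in $\mathbb{F}_{q^2}^*$. $W(t)$ is the number of square-free divisors of $t$. *)

theory Defs
  imports Complex_Main "HOL-Library.Cardinality" "HOL-Computational_Algebra.Squarefree" "HOL-Number_Theory.Number_Theory"
begin

definition is_subfield :: "'a::field set \<Rightarrow> bool" where
  "is_subfield K \<longleftrightarrow> 0 \<in> K \<and> 1 \<in> K \<and>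
     (\<forall>x\<in>K. \<forall>y\<in>K. x + y \<in> K \<and> x * y \<in> K) \<and>
     (\<forall>x\<in>K. - x \<in> K) \<and> (\<forall>x\<in>K. x \<noteq> 0 \<longrightarrow> inverse x \<in> K)"

definition is_basis2 :: "'a::field set \<Rightarrow> 'a \<Rightarrow> 'a \<Rightarrow> bool" where
  "is_basis2 K u v \<longleftrightarrow>
     (\<forall>a\<in>K. \<forall>b\<in>K. a * u + b * v = 0 \<longrightarrow> a = 0 \<and> b = 0) \<and>
     (\<forall>x. \<exists>a\<in>K. \<exists>b\<in>K. x = a * u + b * v)"

definition Tr :: "nat \<Rightarrow> 'a::field \<Rightarrow> 'a" where
  "Tr q x = x + x ^ q"

definition t_free :: "nat \<Rightarrow> 'a::field \<Rightarrow> bool" where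
  "t_free t \<xi> \<longleftrightarrow> \<xi> \<noteq> 0 \<and> (\<forall>d \<zeta>. d dvd t \<and> \<zeta> \<noteq> 0 \<and> \<xi> = \<zeta> ^ d \<longrightarrow> d = 1)"

definition is_nonzero_power :: "nat \<Rightarrow> 'a::field \<Rightarrow> bool" where
  "is_nonzero_power n x \<longleftrightarrow> (\<exists>y. y \<noteq> 0 \<and> x = y ^ n)"

definition Q_count :: "'a::field set \<Rightarrow> 'a \<Rightarrow> 'a \<Rightarrow> nat \<Rightarrow> nat" where
  "Q_count K \<theta>1 \<theta>2 t =
     card {\<alpha> \<in> K. t_free t (\<theta>1 + \<alpha> * \<theta>2) \<and>
                 is_nonzero_power 2 (\<theta>1 + \<alpha> * \<theta>2) \<and> \<not> is_nonzero_power 4 (\<theta>1 + \<alpha> * \<theta>2)}"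

definition W :: "nat \<Rightarrow> nat" where
  "W t = card {d. d dvd t \<and> squarefree d}"

definition odd_radical :: "nat \<Rightarrow> nat" where
  "odd_radical n = \<Prod>{p. prime p \<and> odd p \<and> p dvd n}"

end

theory Submission
  imports Defs "HOL-Library.FuncSet" "HOL-Library.Real_Mod"
begin

text \<open>
  For a multiplicative character \<open>\<chi>\<close> of the big field \<open>F\<close> let \<open>S(\<chi>)\<close> be its sum over the line
  \<open>{\<theta>1 + \<alpha> \<theta>2 | \<alpha> \<in> K}\<close>. The quotients of distinct points of the line run exactly once
  through \<open>F - K\<close>, so \<open>|S(\<chi>)|\<^sup>2 = q - (\<Sum>x\<in>K. \<chi> x)\<close> for \<open>\<chi> \<noteq> 1\<close>. Hence \<open>|S(\<chi>)|\<close> is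
  \<open>1\<close> if \<open>\<chi>\<close> is trivial on the units of \<open>K\<close>, i.e. if its order divides \<open>q + 1\<close>, and \<open>sqrt q\<close> otherwise.

  For a prime \<open>p\<close> dividing \<open>q\<^sup>2 - 1\<close> the indicator of the elements that are not \<open>p\<close>-th powers is
  \<open>(1 - 1/p) (1 + f\<^sub>p)\<close>, where \<open>- f\<^sub>p\<close> is the mean of the \<open>p - 1\<close> characters of order \<open>p\<close>, and
  the indicator of the squares that are not fourth powers is a quarter of an alternating sum of the four
  characters of order dividing 4. Multiplying out over a set \<open>P\<close> of odd primes, a nonempty subset \<open>D\<close>
  of \<open>P\<close> contributes at most \<open>4 sqrt q\<close>, and only \<open>2 + 2 sqrt q\<close> (if \<open>q \<equiv> 1\<close> modulo 4) or 4
  (if \<open>q \<equiv> 3\<close> modulo 4) when all primes of \<open>D\<close> divide \<open>q + 1\<close>; the trivial character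
  contributes \<open>q\<close>. The primes \<open>p\<^sub>1, \<dots>, p\<^sub>s\<close> are treated by the union bound
  \<open>Q(P \<union> R) \<ge> Q(P) - (\<Sum>p\<in>R. Q(P) - Q(P \<union> {p}))\<close>.
\<close>

section \<open>Characters of a finite field\<close>

lemma cis_root_eq_1_iff:
  assumes "N > 0"
  shows "cis (2 * pi * real m / real N) = 1 \<longleftrightarrow> N dvd m"
proof -
  have "cis (2 * pi * real m / real N) = 1 \<longleftrightarrow> (\<exists>n::int. real m = real_of_int (n * int N))"
    using assms by (auto simp: cis_eq_1_iff field_simps)
  also have "\<dots> \<longleftrightarrow> (\<exists>n::int. int m = n * int N)"
    by (metis of_int_eq_iff of_int_of_nat_eq)
  also have "\<dots> \<longleftrightarrow> int N dvd int m"
    by (auto simp: dvd_def mult.commute)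
  finally show ?thesis by simp
qed

lemma cis_root_cong:
  assumes "N > 0" "[m = n] (mod N)"
  shows "cis (2 * pi * real m / real N) = cis (2 * pi * real n / real N)"
  using assms(2)
proof (induction m n rule: linorder_wlog)
  case (le m n)
  then have "N dvd n - m"
    by (metis cong_sym cong_altdef_nat)
  then have "cis (2 * pi * real (n - m) / real N) = 1"
    using assms(1) by (simp add: cis_root_eq_1_iff)
  moreover have "2 * pi * real n / real N = 2 * pi * real m / real N + 2 * pi * real (n - m) / real N"
    using le assms(1) by (simp add: field_simps of_nat_diff)
  ultimately show ?case
    by (simp add: cis_mult [symmetric])
qed (metis cong_sym)

text \<open>A geometric sum whose ratio \<open>?z\<close> is a \<open>d\<close>-th root of unity,
  equal to 1 exactly when \<open>d\<close> divides \<open>n\<close>. All indicator functions below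
  rest on this relation.\<close>

lemma sum_cis_roots:
  assumes "d > 0"
  shows "(\<Sum>j<d. cis (2 * pi * real (j * n) / real d)) = (if d dvd n then of_nat d else 0)"
proof -
  let ?z = "cis (2 * pi * real n / real d)"
  have *: "cis (2 * pi * real (j * n) / real d) = ?z ^ j" for j
    by (simp add: DeMoivre mult_ac)
  have 1: "?z ^ d = 1"
    using assms * [of d] by (metis cis_root_eq_1_iff dvd_triv_left)
  show ?thesis
  proof (cases "d dvd n")
    case True
    then have "?z = 1" using assms by (simp add: cis_root_eq_1_iff)
    with True show ?thesis unfolding * by simp
  next
    case False
    then have "?z \<noteq> 1" using assms by (simp add: cis_root_eq_1_iff)
    with False show ?thesis unfolding * by (simp add: geometric_sum 1)
  qed
qed

section \<open>A generator of the cyclic unit group\<close>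

locale field_generator =
  fixes g :: "'a::{field,finite}" and N :: nat
  assumes N_eq: "N = CARD('a) - 1"
    and generates: "x \<noteq> 0 \<Longrightarrow> \<exists>n. x = g ^ n"
    and pow_eq_iff: "g ^ m = g ^ n \<longleftrightarrow> [m = n] (mod N)"

text \<open>The cyclicity theorem speaks of rings with an explicit carrier. The field type is
  therefore wrapped as the record \<open>R\<close>, and the generator found there is carried
  back.\<close>

lemma ex_field_generator: "\<exists>g::'a::{field,finite}. field_generator g (CARD('a) - 1)"
proof -
  define R where "R = \<lparr>carrier = UNIV :: 'a set, monoid.mult = (*), one = (1::'a), zero = (0::'a), add = (+)\<rparr>"
  have [simp]: "carrier R = UNIV" "monoid.mult R = (*)" "one R = 1" "zero R = 0" "add R = (+)"
    by (simp_all add: R_def)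
  have inv_ex: "\<exists>y. x * y = 1" if "x \<noteq> 0" for x :: 'a
    using that by (intro exI [of _ "inverse x"]) simp
  interpret F: field R
    by unfold_locales
      (auto simp: Units_def mult_ac distrib_left inv_ex intro: exI [of _ "- x" for x]
        left_minus right_minus)
  have "finite (carrier R)" by simp
  then obtain a where a: "a \<in> carrier (mult_of R)"
    and gen: "carrier (mult_of R) = {a [^]\<^bsub>R\<^esub> i | i::nat. i \<in> UNIV}"
    using F.finite_field_mult_group_has_gen by blast
  interpret G: group "mult_of R" by (rule F.field_mult_group)
  have pow: "x [^]\<^bsub>R\<^esub> (n::nat) = x ^ n" for x n
    by (induction n) (auto simp: mult.commute)
  have pow': "x [^]\<^bsub>mult_of R\<^esub> (n::nat) = x ^ n" for x n
    using pow by (simp add: nat_pow_mult_of)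
  have a0: "a \<noteq> 0" using a by simp
  let ?M = "G.ord a"
  have fin: "finite (carrier (mult_of R))" by simp
  have one: "a ^ n = 1 \<longleftrightarrow> ?M dvd n" for n
    using G.pow_eq_id [OF a, of n] by (simp add: pow')
  have M1: "?M \<ge> 1" by (rule G.ord_ge_1 [OF fin a])
  have "carrier (mult_of R) = (\<lambda>x. a ^ x) ` {0..?M - 1}"
    using gen G.ord_elems [OF fin a] by (auto simp: pow pow')
  moreover have "inj_on (\<lambda>x. a ^ x) {0..?M - 1}"
    using G.ord_inj [OF a] by (simp add: pow')
  \<comment> \<open>The powers below the order of \<open>a\<close> list the units without
    repetition, so this order is the number of units.\<close>
  ultimately have "card (carrier (mult_of R)) = ?M"
    using M1 by (simp add: card_image)
  then have M: "?M = CARD('a) - 1" by (simp add: card_Diff_singleton)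
  have cong: "a ^ m = a ^ n \<longleftrightarrow> [m = n] (mod ?M)" for m n
  proof (induction m n rule: linorder_wlog)
    case (le m n)
    have "a ^ n = a ^ m * a ^ (n - m)" using le by (simp flip: power_add)
    then have "a ^ m = a ^ n \<longleftrightarrow> a ^ (n - m) = 1" using a0 by auto
    also have "\<dots> \<longleftrightarrow> [m = n] (mod ?M)"
      using le by (metis one cong_sym_eq cong_altdef_nat)
    finally show ?case .
  next
    case (sym m n)
    then show ?case by (metis cong_sym_eq)
  qed
  have "field_generator a (CARD('a) - 1)"
  proof
    show "CARD('a) - 1 = CARD('a) - 1" ..
    show "\<exists>n. x = a ^ n" if "x \<noteq> 0" for x
      using gen that by (auto simp: pow)
    show "a ^ m = a ^ n \<longleftrightarrow> [m = n] (mod (CARD('a) - 1))" for m n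
      using cong M by simp
  qed
  then show ?thesis ..
qed

context field_generator
begin

lemma N_pos: "N > 0"
proof -
  have "card {0, 1 :: 'a} \<le> CARD('a)" by (rule card_mono) auto
  then show ?thesis by (simp add: N_eq)
qed

lemma g_nonzero [simp]: "g \<noteq> 0"
proof
  assume "g = 0"
  have "g ^ N = 1" using pow_eq_iff [of N 0] by (simp add: cong_def)
  with \<open>g = 0\<close> N_pos show False by (simp add: zero_power)
qed

text \<open>For nonzero \<open>x\<close> any exponent will do: it is unique modulo \<open>N\<close>,
  and \<open>chi\<close> depends on it only modulo \<open>N\<close>.\<close>

definition dlog :: "'a \<Rightarrow> nat" where "dlog x = (SOME n. g ^ n = x)"

text \<open>The multiplicative characters, extended by 0 at 0. The index is an exponent modulo
  \<open>N\<close>, so products of characters become sums of indices, and \<open>chi a\<close> is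
  trivial iff \<open>N dvd a\<close>.\<close>

definition chi :: "nat \<Rightarrow> 'a \<Rightarrow> complex" where
  "chi a x = (if x = 0 then 0 else cis (2 * pi * real (a * dlog x) / real N))"

lemma chi_0 [simp]: "chi a 0 = 0"
  by (simp add: chi_def)

lemma chi_power: "chi a (g ^ n) = cis (2 * pi * real (a * n) / real N)"
proof -
  have "g ^ dlog (g ^ n) = g ^ n" unfolding dlog_def by (rule someI) (rule refl)
  then have "[a * dlog (g ^ n) = a * n] (mod N)"
    by (intro cong_mult cong_refl) (simp add: pow_eq_iff)
  then show ?thesis
    using cis_root_cong [OF N_pos] by (simp add: chi_def del: of_nat_mult)
qed

lemma chi_mult: "chi a (x * y) = chi a x * chi a y"
proof (cases "x = 0 \<or> y = 0")
  case False
  then obtain m n where [simp]: "x = g ^ m" "y = g ^ n" using generates by meson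
  have "chi a (x * y) = chi a (g ^ (m + n))" by (simp add: power_add)
  then show ?thesis
    by (simp only: chi_power \<open>x = g ^ m\<close> \<open>y = g ^ n\<close>) (simp add: cis_mult ring_distribs add_divide_distrib)
qed auto

lemma chi_add: "chi (a + b) x = chi a x * chi b x"
  by (simp add: chi_def cis_mult ring_distribs add_divide_distrib)

lemma chi_zero_left: "x \<noteq> 0 \<Longrightarrow> chi 0 x = 1"
  by (simp add: chi_def)

lemma chi_sum:
  "finite A \<Longrightarrow> x \<noteq> 0 \<Longrightarrow> chi (\<Sum>i\<in>A. f i) x = (\<Prod>i\<in>A. chi (f i) x)"
  by (induction A rule: finite_induct) (simp_all add: chi_add chi_zero_left)

lemma norm_chi: "x \<noteq> 0 \<Longrightarrow> norm (chi a x) = 1"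
  by (simp add: chi_def)

text \<open>Values at units lie on the unit circle, where the inverse is the conjugate.\<close>

lemma chi_divide: "y \<noteq> 0 \<Longrightarrow> chi a (x / y) = chi a x * cnj (chi a y)"
proof -
  assume y: "y \<noteq> 0"
  have "chi a x = chi a (x / y) * chi a y" using y by (simp flip: chi_mult)
  then have "chi a x * cnj (chi a y) = chi a (x / y) * (chi a y * cnj (chi a y))" by simp
  also have "chi a y * cnj (chi a y) = 1"
    using norm_chi [OF y, of a] by (simp add: complex_norm_square [symmetric])
  finally show ?thesis by simp
qed

text \<open>Substituting \<open>c * x\<close> for \<open>x\<close> multiplies the sum by
  \<open>chi a c\<close>, which differs from 1. It is applied with \<open>H\<close> the whole field
  and with \<open>H\<close> the subfield.\<close>

lemma sum_chi_invariant:
  assumes "c \<noteq> 0" "chi a c \<noteq> 1" "(\<lambda>x. c * x) ` H = H"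
  shows "(\<Sum>x\<in>H. chi a x) = 0"
proof -
  have "(\<Sum>x\<in>H. chi a x) = (\<Sum>x\<in>(\<lambda>x. c * x) ` H. chi a x)" using assms by simp
  also have "\<dots> = chi a c * (\<Sum>x\<in>H. chi a x)"
    using assms(1) by (subst sum.reindex) (auto simp: inj_on_def chi_mult sum_distrib_left)
  finally show ?thesis using assms(2) by (simp add: algebra_simps)
qed

lemma sum_chi_UNIV:
  assumes "\<not> N dvd a"
  shows "(\<Sum>x\<in>UNIV. chi a x) = 0"
proof (rule sum_chi_invariant [of g])
  have "chi a (g ^ 1) \<noteq> 1"
    unfolding chi_power using assms by (simp add: cis_root_eq_1_iff [OF N_pos] del: power_one_right)
  then show "chi a g \<noteq> 1" by simp
  show "(\<lambda>x. g * x) ` UNIV = UNIV"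
    by (intro endo_inj_surj) (auto simp: inj_on_def)
qed simp

section \<open>Indicators of power residues\<close>

lemma is_nonzero_power_iff:
  assumes "d dvd N"
  shows "is_nonzero_power d (g ^ n) \<longleftrightarrow> d dvd n"
proof
  assume "is_nonzero_power d (g ^ n)"
  then obtain y where y: "y \<noteq> 0" "g ^ n = y ^ d" by (auto simp: is_nonzero_power_def)
  then obtain m where "y = g ^ m" using generates by blast
  with y have "g ^ n = g ^ (m * d)" by (simp add: power_mult)
  then have "[n = m * d] (mod N)" by (simp add: pow_eq_iff)
  \<comment> \<open>Since \<open>d\<close> divides \<open>N\<close>, an exponent known modulo
    \<open>N\<close> has a well-defined residue modulo \<open>d\<close>.\<close>
  then have "[n = m * d] (mod d)" using assms by (rule cong_dvd_modulus_nat)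
  then show "d dvd n" by (simp add: cong_def mod_eq_0_iff_dvd)
next
  assume "d dvd n"
  then obtain m where "n = d * m" ..
  then show "is_nonzero_power d (g ^ n)"
    by (auto simp: is_nonzero_power_def mult.commute simp flip: power_mult intro!: exI [of _ "g ^ m"])
qed

text \<open>The indices \<open>j * (N div d)\<close> give the characters of order dividing
  \<open>d\<close>; their values depend on the exponent of the argument only modulo
  \<open>d\<close>.\<close>

lemma chi_div_power:
  assumes "d dvd N" "d > 0"
  shows "chi (j * (N div d)) (g ^ n) = cis (2 * pi * real (j * n) / real d)"
proof -
  have "real N = real d * real (N div d)"
    using assms by (metis dvd_mult_div_cancel of_nat_mult)
  moreover have "N div d > 0"
    using assms N_pos by (metis dvd_mult_div_cancel mult_0_right neq0_conv)
  ultimately show ?thesis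
    unfolding chi_power using assms(2) by (simp add: field_simps)
qed

definition nonpow :: "nat \<Rightarrow> 'a \<Rightarrow> complex" where
  "nonpow p x = - (\<Sum>j\<in>{1..<p}. chi (j * (N div p)) x) / of_nat (p - 1)"

text \<open>By orthogonality \<open>nonpow p x\<close> is -1 at \<open>p\<close>-th powers and
  \<open>1 / (p - 1)\<close> at other units, so \<open>1 + nonpow p x\<close> is 0 or
  \<open>p / (p - 1)\<close>.\<close>

lemma nonpower_indicator:
  assumes "prime p" "p dvd N" "x \<noteq> 0"
  shows "of_real (1 - 1 / real p) * (1 + nonpow p x) = of_bool (\<not> is_nonzero_power p x)"
proof -
  have p: "p > 1" using assms(1) by (rule prime_gt_1_nat)
  obtain n where n: "x = g ^ n" using generates assms by blast
  have "(\<Sum>j<p. chi (j * (N div p)) x) = (if p dvd n then of_nat p else 0)"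
    unfolding n using p assms(2) by (simp add: chi_div_power sum_cis_roots del: of_nat_mult)
  \<comment> \<open>The trivial character \<open>j = 0\<close> contributes the 1.\<close>
  moreover have "(\<Sum>j<p. chi (j * (N div p)) x) = 1 + (\<Sum>j\<in>{1..<p}. chi (j * (N div p)) x)"
    using p assms(3)
    by (simp add: lessThan_atLeast0 sum.atLeast_Suc_lessThan chi_zero_left)
  ultimately have "(\<Sum>j\<in>{1..<p}. chi (j * (N div p)) x) = (if p dvd n then of_nat p else 0) - 1"
    by (simp add: algebra_simps)
  then have "nonpow p x = - ((if p dvd n then of_nat p else 0) - 1) / (of_nat p - 1)"
    using p by (simp add: nonpow_def of_nat_diff)
  moreover have "is_nonzero_power p x \<longleftrightarrow> p dvd n"
    unfolding n using assms(2) by (rule is_nonzero_power_iff)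
  moreover have "of_nat p \<noteq> (1::complex)" "of_nat p \<noteq> (0::complex)" using p by auto
  ultimately show ?thesis by (auto simp: field_simps)
qed

definition sqpart :: "'a \<Rightarrow> complex" where
  "sqpart x = (\<Sum>i<4. (-1) ^ i * chi (i * (N div 4)) x)"

text \<open>The sign \<open>(-1) ^ i\<close> is itself a fourth root of unity to the power
  \<open>2 * i\<close>. It shifts the exponent \<open>n\<close> by 2, so the sum detects
  \<open>n\<close> congruent to 2 modulo 4.\<close>

lemma square_nonquartic_indicator:
  assumes "4 dvd N" "x \<noteq> 0"
  shows "sqpart x = 4 * of_bool (is_nonzero_power 2 x \<and> \<not> is_nonzero_power 4 x)"
proof -
  obtain n where n: "x = g ^ n" using generates assms by blast
  have "(-1) ^ i * chi (i * (N div 4)) x = cis (2 * pi * real (i * (n + 2)) / real 4)" for i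
  proof -
    have "(-1) ^ i = cis (real i * pi)"
      by (simp flip: DeMoivre)
    then show ?thesis
      unfolding n using assms(1) by (simp add: chi_div_power cis_mult) (simp add: algebra_simps add_divide_distrib)
  qed
  then have "sqpart x = (\<Sum>i<4. cis (2 * pi * real (i * (n + 2)) / real 4))"
    by (simp add: sqpart_def)
  also have "\<dots> = (if 4 dvd n + 2 then of_nat 4 else 0)"
    by (rule sum_cis_roots) simp
  also have "4 dvd n + 2 \<longleftrightarrow> 2 dvd n \<and> \<not> 4 dvd n" by presburger
  finally show ?thesis
    using assms(1) dvd_trans [OF _ assms(1), of 2]
    by (simp add: n is_nonzero_power_iff)
qed

end

section \<open>Character sums over an affine line\<close>

locale affine_line = field_generator g N for g :: "'a::{field,finite}" and N +
  fixes q :: nat and K :: "'a set" and \<theta>1 \<theta>2 :: 'a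
  assumes odd_q: "odd q" and card_UNIV: "CARD('a) = q\<^sup>2"
    and subfield: "is_subfield K" and card_K: "card K = q"
    and basis: "is_basis2 K \<theta>1 \<theta>2"
begin

section \<open>Points of the line and their quotients\<close>

definition point :: "'a \<Rightarrow> 'a" where "point \<alpha> = \<theta>1 + \<alpha> * \<theta>2"

lemma K_closed:
  "0 \<in> K" "1 \<in> K" "x \<in> K \<Longrightarrow> y \<in> K \<Longrightarrow> x + y \<in> K" "x \<in> K \<Longrightarrow> y \<in> K \<Longrightarrow> x * y \<in> K"
  "x \<in> K \<Longrightarrow> - x \<in> K" "x \<in> K \<Longrightarrow> inverse x \<in> K"
proof -
  show "x \<in> K \<Longrightarrow> inverse x \<in> K"
    using subfield by (cases "x = 0") (auto simp: is_subfield_def)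
qed (use subfield in \<open>auto simp: is_subfield_def\<close>)

lemma K_diff: "x \<in> K \<Longrightarrow> y \<in> K \<Longrightarrow> x - y \<in> K"
  using K_closed(3) [of x "- y"] K_closed(5) [of y] by simp

lemma K_divide: "x \<in> K \<Longrightarrow> y \<in> K \<Longrightarrow> x / y \<in> K"
  by (simp add: divide_inverse K_closed)

lemma basis_eq_iff:
  assumes "a \<in> K" "b \<in> K" "c \<in> K" "d \<in> K"
  shows "a * \<theta>1 + b * \<theta>2 = c * \<theta>1 + d * \<theta>2 \<longleftrightarrow> a = c \<and> b = d"
proof
  assume "a * \<theta>1 + b * \<theta>2 = c * \<theta>1 + d * \<theta>2"
  then have "(a - c) * \<theta>1 + (b - d) * \<theta>2 = 0" by (simp add: algebra_simps)
  moreover have "a - c \<in> K" "b - d \<in> K" using assms K_diff by auto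
  ultimately have "a - c = 0 \<and> b - d = 0"
    using basis unfolding is_basis2_def by blast
  then show "a = c \<and> b = d" by simp
qed simp

lemma point_nonzero: "\<alpha> \<in> K \<Longrightarrow> point \<alpha> \<noteq> 0"
  using basis_eq_iff [of 1 \<alpha> 0 0] by (simp add: point_def K_closed)

lemma theta2_nonzero: "\<theta>2 \<noteq> 0"
  using basis_eq_iff [of 0 1 0 0] by (auto simp: K_closed)

lemma q_ge_3: "q \<ge> 3"
proof -
  have "card {0, 1 :: 'a} \<le> card K" by (rule card_mono) (auto simp: K_closed)
  with odd_q show ?thesis by (simp add: card_K) presburger
qed

lemma N_factor: "N = (q - 1) * (q + 1)"
  by (simp add: N_eq card_UNIV power2_eq_square algebra_simps)

lemma four_dvd_N: "4 dvd N"
proof -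
  have "2 dvd q - 1" "2 dvd q + 1" using odd_q by auto
  then have "2 * 2 dvd (q - 1) * (q + 1)" by (rule mult_dvd_mono)
  then show ?thesis by (simp add: N_factor)
qed

text \<open>This turns the off-diagonal part of a squared line sum into a character sum over the
  complement of \<open>K\<close>.\<close>

lemma bij_betw_ratio:
  "bij_betw (\<lambda>(a, b). point a / point b) {(a, b) \<in> K \<times> K. a \<noteq> b} (UNIV - K)"
proof -
  let ?A = "{(a, b) \<in> K \<times> K. a \<noteq> b}" and ?r = "\<lambda>(a, b). point a / point b"
  have notin: "point a / point b \<notin> K" if "a \<in> K" "b \<in> K" "a \<noteq> b" for a b
  proof
    assume z: "point a / point b \<in> K"
    define z where "z = point a / point b"
    have "point a = z * point b" using point_nonzero that by (simp add: z_def)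
    \<comment> \<open>Were the quotient \<open>z\<close> in \<open>K\<close>, comparing coordinates
      would give \<open>z = 1\<close> and then \<open>a = b\<close>.\<close>
    then have "1 * \<theta>1 + a * \<theta>2 = z * \<theta>1 + (z * b) * \<theta>2" by (simp add: point_def algebra_simps)
    then have "1 = z \<and> a = z * b"
      using that z unfolding z_def [symmetric] by (subst (asm) basis_eq_iff) (auto simp: K_closed)
    with that show False by auto
  qed
  have "inj_on ?r ?A"
  proof (rule inj_onI, clarify)
    fix a b a' b' assume K: "a \<in> K" "b \<in> K" "a' \<in> K" "b' \<in> K"
      and ne: "a \<noteq> b" "a' \<noteq> b'" and eq: "point a / point b = point a' / point b'"
    define z where "z = point a / point b"
    have "point a = z * point b" using point_nonzero K by (simp add: z_def)
    moreover have "point a' = z * point b'" unfolding z_def eq using point_nonzero K by simp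
    \<comment> \<open>Subtracting eliminates \<theta>1. Unless \<open>b = b'\<close>, the quotient
      \<open>z\<close> is then a quotient of elements of \<open>K\<close>, which was just
      excluded.\<close>
    ultimately have "point a - point a' = z * (point b - point b')" by (simp add: algebra_simps)
    then have "(a - a') * \<theta>2 = (z * (b - b')) * \<theta>2" by (simp add: point_def algebra_simps)
    then have *: "a - a' = z * (b - b')" using theta2_nonzero by simp
    have "b = b'"
    proof (rule ccontr)
      assume "b \<noteq> b'"
      then have "z = (a - a') / (b - b')" using * by (simp add: field_simps)
      then have "z \<in> K" using K by (simp add: K_diff K_divide)
      then show False using notin K ne by (simp add: z_def)
    qed
    with * show "a = a' \<and> b = b'" by simp
  qed
  moreover have "?r ` ?A = UNIV - K"
  proof (rule card_subset_eq)
    show "?r ` ?A \<subseteq> UNIV - K" using notin by auto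
    \<comment> \<open>Surjectivity by counting: there are \<open>q\<^sup>2 - q\<close> ordered pairs
      of distinct elements of \<open>K\<close> and as many elements outside
      \<open>K\<close>.\<close>
    have "card (K \<times> K) = card (?A \<union> (\<lambda>a. (a, a)) ` K)"
      by (rule arg_cong [where f = card]) auto
    also have "\<dots> = card ?A + card ((\<lambda>a. (a, a)) ` K)"
      by (rule card_Un_disjoint) auto
    also have "card ((\<lambda>a. (a, a)) ` K) = q"
      by (subst card_image) (auto simp: inj_on_def card_K)
    finally have "q\<^sup>2 = card ?A + q" by (simp add: card_cartesian_product card_K power2_eq_square)
    then have "card (?r ` ?A) = q\<^sup>2 - q"
      using \<open>inj_on ?r ?A\<close> by (simp add: card_image)
    then show "card (?r ` ?A) = card (UNIV - K)"
      by (simp add: card_Diff_subset card_UNIV card_K)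
  qed simp
  ultimately show ?thesis by (simp add: bij_betw_def)
qed

definition line_sum :: "nat \<Rightarrow> complex" where "line_sum a = (\<Sum>\<alpha>\<in>K. chi a (point \<alpha>))"

text \<open>Expanding the square gives a double sum of \<open>chi a\<close> over quotients of
  points. The diagonal yields \<open>q\<close>; the rest is the sum over the complement of
  \<open>K\<close>, which is minus the sum over \<open>K\<close> because the full sum
  vanishes.\<close>

lemma norm_line_sum_square:
  assumes "\<not> N dvd a"
  shows "of_real ((cmod (line_sum a))\<^sup>2) = of_nat q - (\<Sum>x\<in>K. chi a x)"
proof -
  let ?A = "{(a, b) \<in> K \<times> K. a \<noteq> b}" and ?r = "\<lambda>(a, b). point a / point b"
  have "of_real ((cmod (line_sum a))\<^sup>2) = line_sum a * cnj (line_sum a)" by (rule complex_norm_square)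
  also have "\<dots> = (\<Sum>\<alpha>\<in>K. \<Sum>\<gamma>\<in>K. chi a (point \<alpha>) * cnj (chi a (point \<gamma>)))"
    by (simp add: line_sum_def cnj_sum sum_product)
  also have "\<dots> = (\<Sum>\<alpha>\<in>K. \<Sum>\<gamma>\<in>K. chi a (point \<alpha> / point \<gamma>))"
    by (intro sum.cong refl) (simp add: chi_divide point_nonzero)
  also have "\<dots> = (\<Sum>z\<in>K \<times> K. chi a (?r z))"
    by (simp add: sum.cartesian_product case_prod_unfold)
  also have "K \<times> K = ?A \<union> (\<lambda>a. (a, a)) ` K" by auto
  also have "(\<Sum>z\<in>?A \<union> (\<lambda>a. (a, a)) ` K. chi a (?r z)) =
      (\<Sum>z\<in>?A. chi a (?r z)) + (\<Sum>z\<in>(\<lambda>a. (a, a)) ` K. chi a (?r z))"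
    by (rule sum.union_disjoint) auto
  also have "(\<Sum>z\<in>(\<lambda>a. (a, a)) ` K. chi a (?r z)) = (\<Sum>\<alpha>\<in>K. chi a (point \<alpha> / point \<alpha>))"
    by (subst sum.reindex) (auto simp: inj_on_def)
  also have "\<dots> = (\<Sum>\<alpha>\<in>K. 1)"
  proof (rule sum.cong)
    fix \<alpha> assume "\<alpha> \<in> K"
    then have "point \<alpha> / point \<alpha> = g ^ 0" using point_nonzero by simp
    then show "chi a (point \<alpha> / point \<alpha>) = 1" by (simp only: chi_power) simp
  qed simp
  also have "\<dots> = of_nat q" by (simp add: card_K)
  also have "(\<Sum>z\<in>?A. chi a (?r z)) = (\<Sum>z\<in>UNIV - K. chi a z)"
    by (rule sum.reindex_bij_betw [OF bij_betw_ratio])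
  also have "\<dots> = (\<Sum>z\<in>UNIV. chi a z) - (\<Sum>z\<in>K. chi a z)"
    by (rule sum_diff) auto
  finally show ?thesis using sum_chi_UNIV [OF assms] by simp
qed

section \<open>Characters restricted to the units of the subfield\<close>

lemma mult_image_K:
  assumes "c \<in> K" "c \<noteq> 0"
  shows "(\<lambda>x. c * x) ` K = K"
  using assms by (intro endo_inj_surj) (auto simp: inj_on_def K_closed)

text \<open>As in Fermat's little theorem: multiplication by \<open>x\<close> permutes the units of
  \<open>K\<close>, so their nonzero product is multiplied by \<open>x ^ (q - 1)\<close> and stays
  the same.\<close>

lemma K_power:
  assumes "x \<in> K" "x \<noteq> 0"
  shows "x ^ (q - 1) = 1"
proof -
  let ?U = "K - {0}"
  have inj: "inj_on (\<lambda>y. x * y) ?U" using assms by (auto simp: inj_on_def)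
  have "(\<lambda>y. x * y) ` ?U = ?U"
    using assms by (intro endo_inj_surj inj) (auto simp: K_closed)
  then have "\<Prod>?U = \<Prod>((\<lambda>y. x * y) ` ?U)" by simp
  also have "\<dots> = (\<Prod>y\<in>?U. x * y)" using inj by (simp add: prod.reindex)
  also have "\<dots> = x ^ card ?U * \<Prod>?U" by (simp add: prod.distrib)
  also have "card ?U = q - 1" by (simp add: card_Diff_singleton K_closed card_K)
  finally have "(x ^ (q - 1) - 1) * \<Prod>?U = 0" by (simp add: algebra_simps)
  then show ?thesis by simp
qed

lemma units_K: "K - {0} = (\<lambda>j. g ^ ((q + 1) * j)) ` {..<q - 1}"
proof -
  let ?h = "\<lambda>j. g ^ ((q + 1) * j)"
  have "K - {0} \<subseteq> ?h ` {..<q - 1}"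
  proof
    fix x assume x: "x \<in> K - {0}"
    then obtain n where n: "x = g ^ n" using generates by blast
    have "g ^ (n * (q - 1)) = g ^ 0" using K_power [of x] x by (simp add: n power_mult)
    then have "N dvd n * (q - 1)" by (simp only: pow_eq_iff cong_0_iff)
    \<comment> \<open>Cancelling \<open>q - 1\<close> shows that the exponent of a unit of
      \<open>K\<close> is a multiple of \<open>q + 1\<close>.\<close>
    then have "(q - 1) * (q + 1) dvd (q - 1) * n" by (simp add: N_factor mult.commute)
    then have "q + 1 dvd n" using q_ge_3 by (simp only: nat_mult_dvd_cancel_disj) auto
    moreover have "q + 1 dvd N" unfolding N_factor by (rule dvd_triv_right)
    ultimately have "q + 1 dvd n mod N" by (simp add: dvd_mod_iff)
    then obtain j where j: "n mod N = (q + 1) * j" ..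
    have "n mod N < (q + 1) * (q - 1)"
      using N_pos by (simp add: N_factor mult.commute)
    then have "j < q - 1" unfolding j by (rule mult_less_cancel1 [THEN iffD1, THEN conjunct2])
    moreover have "x = ?h j"
      unfolding n j [symmetric] by (simp add: pow_eq_iff cong_def)
    ultimately show "x \<in> ?h ` {..<q - 1}" by blast
  qed
  \<comment> \<open>The right side has at most \<open>q - 1\<close> elements, so the inclusion is an
    equality.\<close>
  moreover have "card (?h ` {..<q - 1}) \<le> card (K - {0})"
    using card_image_le [of "{..<q - 1}" ?h] by (simp add: card_Diff_singleton K_closed card_K)
  ultimately show ?thesis by (intro card_seteq) auto
qed

text \<open>On the units of \<open>K\<close>, which are the powers of \<open>g ^ (q + 1)\<close>,
  the character is trivial iff its value at that generator is 1, that is iff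
  \<open>N dvd a * (q + 1)\<close>.\<close>

lemma sum_chi_K:
  "(\<Sum>x\<in>K. chi a x) = (if N dvd a * (q + 1) then of_nat q - 1 else 0)"
proof (cases "N dvd a * (q + 1)")
  case True
  have "(\<Sum>x\<in>K. chi a x) = (\<Sum>x\<in>K - {0}. chi a x)"
    by (simp add: sum.remove [of K 0] K_closed)
  also have "\<dots> = (\<Sum>x\<in>K - {0}. 1)"
  proof (rule sum.cong)
    fix x assume "x \<in> K - {0}"
    then obtain j where "x = g ^ ((q + 1) * j)" unfolding units_K by blast
    moreover have "N dvd a * ((q + 1) * j)" using True by (metis dvd_mult2 mult.assoc)
    ultimately show "chi a x = 1"
      by (simp only: chi_power cis_root_eq_1_iff [OF N_pos])
  qed simp
  also have "\<dots> = of_nat q - 1"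
    using q_ge_3 by (simp add: card_Diff_singleton K_closed card_K of_nat_diff)
  finally show ?thesis using True by simp
next
  case False
  \<comment> \<open>The index 1 lies below \<open>q - 1\<close> because \<open>q\<close> is at least
    3.\<close>
  have "g ^ ((q + 1) * 1) \<in> (\<lambda>j. g ^ ((q + 1) * j)) ` {..<q - 1}"
    by (rule imageI) (use q_ge_3 in auto)
  then have "g ^ (q + 1) \<in> K - {0}" unfolding units_K by simp
  then have "g ^ (q + 1) \<in> K" "g ^ (q + 1) \<noteq> 0" by blast+
  moreover have "chi a (g ^ (q + 1)) \<noteq> 1"
    using False by (simp only: chi_power cis_root_eq_1_iff [OF N_pos]) simp
  ultimately have "(\<Sum>x\<in>K. chi a x) = 0"
    by (intro sum_chi_invariant [of "g ^ (q + 1)"] mult_image_K)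
  with False show ?thesis by simp
qed

text \<open>The squared norm is \<open>q - (q - 1)\<close> or \<open>q - 0\<close>.\<close>

lemma norm_line_sum:
  assumes "\<not> N dvd a"
  shows "cmod (line_sum a) = (if N dvd a * (q + 1) then 1 else sqrt (real q))"
proof -
  have "complex_of_real ((cmod (line_sum a))\<^sup>2) = of_real (if N dvd a * (q + 1) then 1 else real q)"
    using norm_line_sum_square [OF assms] by (simp add: sum_chi_K)
  then have "(cmod (line_sum a))\<^sup>2 = (if N dvd a * (q + 1) then 1 else real q)"
    by (simp only: of_real_eq_iff)
  then have "cmod (line_sum a) = sqrt (if N dvd a * (q + 1) then 1 else real q)"
    by (metis norm_ge_zero real_sqrt_unique)
  then show ?thesis by simp
qed

lemma line_sum_0: "line_sum 0 = of_nat q"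
  by (simp add: line_sum_def chi_zero_left point_nonzero card_K)

end

section \<open>Counting by characters\<close>

lemma dvd_mult_div_iff:
  fixes N d c :: nat
  assumes "d dvd N" "N > 0"
  shows "N dvd c * (N div d) \<longleftrightarrow> d dvd c"
proof -
  obtain m where m: "N = d * m" using assms(1) ..
  with assms(2) have "d > 0" "m > 0" by auto
  then show ?thesis by (simp add: m nat_mult_dvd_cancel_disj mult.commute)
qed

context affine_line
begin

section \<open>Products of characters of order dividing 4 and of odd prime order\<close>

definition odd_prime_divisors :: "nat set" where
  "odd_prime_divisors = {p. prime p \<and> odd p \<and> p dvd N}"

lemma finite_odd_prime_divisors [simp]: "finite odd_prime_divisors"
  by (rule finite_subset [of _ "{..N}"]) (use N_pos in \<open>auto simp: odd_prime_divisors_def dest: dvd_imp_le\<close>)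

text \<open>Index of the product of the \<open>i\<close>-th character of order dividing 4 with one
  character of order \<open>p\<close> for each \<open>p\<close> in \<open>D\<close>; the choice
  function \<open>j\<close> selects the latter.\<close>

definition expo :: "nat \<Rightarrow> (nat \<Rightarrow> nat) \<Rightarrow> nat set \<Rightarrow> nat" where
  "expo i j D = i * (N div 4) + (\<Sum>p\<in>D. j p * (N div p))"

text \<open>Multiplying by 4 and by all primes of \<open>D\<close> except \<open>r\<close> kills every summand of the exponent
  but the one belonging to \<open>r\<close>.\<close>

lemma not_dvd_expo:
  assumes D: "D \<subseteq> odd_prime_divisors" and r: "r \<in> D" and j: "j \<in> PiE D (\<lambda>p. {1..<p})"
    and c: "\<not> r dvd c"
  shows "\<not> N dvd expo i j D * c"
proof
  assume dvd: "N dvd expo i j D * c"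
  have fin: "finite D" using D finite_odd_prime_divisors by (rule finite_subset)
  define m where "m = c * 4 * \<Prod>(D - {r})"
  have rp: "prime r" "odd r" "r dvd N" using D r by (auto simp: odd_prime_divisors_def)
  have four: "N dvd m * (i * (N div 4))"
  proof -
    have "N dvd 4 * (N div 4)" using four_dvd_N by simp
    then have "N dvd (c * \<Prod>(D - {r}) * i) * (4 * (N div 4))" by (rule dvd_mult)
    then show ?thesis by (simp add: m_def mult_ac)
  qed
  have other: "N dvd m * (\<Sum>p\<in>D - {r}. j p * (N div p))"
    unfolding sum_distrib_left
  proof (rule dvd_sum)
    fix p assume p: "p \<in> D - {r}"
    then have "p dvd N" using D by (auto simp: odd_prime_divisors_def)
    moreover have "p dvd m"
      unfolding m_def using p fin by (intro dvd_mult dvd_prodI) auto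
    ultimately have "N dvd (m * j p) * (N div p)"
      using N_pos by (simp only: dvd_mult_div_iff dvd_mult2)
    then show "N dvd m * (j p * (N div p))" by (simp only: mult.assoc)
  qed
  have "N dvd m * expo i j D"
  proof -
    have "N dvd (4 * \<Prod>(D - {r})) * (expo i j D * c)" using dvd by (rule dvd_mult)
    then show ?thesis by (simp add: m_def mult_ac)
  qed
  moreover have "m * expo i j D = m * (i * (N div 4)) + m * (\<Sum>p\<in>D - {r}. j p * (N div p))
      + m * (j r * (N div r))"
    unfolding expo_def sum.remove [OF fin r] by (simp only: distrib_left add_ac)
  ultimately have "N dvd m * (j r * (N div r))"
    using dvd_add [OF four other] by (simp only: dvd_add_right_iff)
  then have "N dvd (m * j r) * (N div r)" by (simp add: mult_ac)
  then have "r dvd m * j r" using rp N_pos by (subst (asm) dvd_mult_div_iff) auto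
  \<comment> \<open>Each alternative is impossible: \<open>c\<close> by assumption, 4 since
    \<open>r\<close> is odd, the product since its primes differ from \<open>r\<close>, and
    \<open>j r\<close> since it lies strictly between 0 and \<open>r\<close>.\<close>
  then have "r dvd c \<or> r dvd 4 \<or> r dvd \<Prod>(D - {r}) \<or> r dvd j r"
    using rp(1) unfolding m_def by (simp only: prime_dvd_mult_iff) blast
  moreover have "\<not> r dvd 4"
  proof
    assume "r dvd 4"
    then have "r dvd 2 ^ 2" by simp
    then have "r dvd 2" using rp(1) prime_dvd_power by blast
    then have "r = 2" using rp(1) two_is_prime_nat by (rule primes_dvd_imp_eq [rotated 2])
    with rp(2) show False by simp
  qed
  moreover have "\<not> r dvd \<Prod>(D - {r})"
  proof
    assume "r dvd \<Prod>(D - {r})"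
    then obtain p where "p \<in> D - {r}" "r dvd p"
      using rp(1) fin by (auto simp: prime_dvd_prod_iff)
    moreover from this D have "prime p" by (auto simp: odd_prime_divisors_def)
    ultimately show False using primes_dvd_imp_eq [OF rp(1)] by blast
  qed
  moreover have "\<not> r dvd j r"
  proof -
    have "j r \<in> {1..<r}" using j r by (rule PiE_mem)
    then show ?thesis using nat_dvd_not_less [of "j r" r] by simp
  qed
  ultimately show False using c by blast
qed

lemma not_dvd_expo_empty: "0 < i \<Longrightarrow> i < 4 \<Longrightarrow> \<not> N dvd expo i j {}"
  unfolding expo_def using N_pos four_dvd_N
  by (simp add: dvd_mult_div_iff) (auto dest: dvd_imp_le)

text \<open>Multiplication by \<open>q + 1\<close> kills every summand of the exponent separately.
  The conclusion is the criterion in \<open>norm_line_sum\<close> for the small value 1.\<close>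

lemma dvd_expo:
  assumes D: "D \<subseteq> odd_prime_divisors" "\<forall>p\<in>D. p dvd q + 1" and i: "4 dvd (q + 1) * i"
  shows "N dvd expo i j D * (q + 1)"
proof -
  have "N dvd ((q + 1) * i) * (N div 4)"
    using i N_pos four_dvd_N by (simp only: dvd_mult_div_iff)
  moreover have "N dvd (\<Sum>p\<in>D. ((q + 1) * j p) * (N div p))"
  proof (rule dvd_sum)
    fix p assume "p \<in> D"
    then have "p dvd N" "p dvd (q + 1) * j p"
      using D by (auto simp: odd_prime_divisors_def simp del: mult_Suc intro!: dvd_mult2)
    then show "N dvd ((q + 1) * j p) * (N div p)" using N_pos by (simp only: dvd_mult_div_iff)
  qed
  ultimately have "N dvd ((q + 1) * i) * (N div 4) + (\<Sum>p\<in>D. ((q + 1) * j p) * (N div p))"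
    by (rule dvd_add)
  also have "\<dots> = expo i j D * (q + 1)"
    unfolding expo_def distrib_right [of _ _ "q + 1"] sum_distrib_right by (simp only: mult_ac)
  finally show ?thesis .
qed

section \<open>Bounds for the terms of the expanded indicator\<close>

definition sieve_sum_part :: "nat \<Rightarrow> nat set \<Rightarrow> complex" where
  "sieve_sum_part i D = (\<Sum>\<alpha>\<in>K. chi (i * (N div 4)) (point \<alpha>) * (\<Prod>p\<in>D. nonpow p (point \<alpha>)))"

definition sieve_sum :: "nat set \<Rightarrow> complex" where
  "sieve_sum D = (\<Sum>\<alpha>\<in>K. sqpart (point \<alpha>) * (\<Prod>p\<in>D. nonpow p (point \<alpha>)))"

lemma sieve_sum_eq_sum_sieve_sum_part: "sieve_sum D = (\<Sum>i<4. (-1) ^ i * sieve_sum_part i D)"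
  unfolding sieve_sum_def sieve_sum_part_def sqpart_def sum_distrib_left sum_distrib_right
  by (subst sum.swap) (simp only: mult.assoc)

text \<open>Multiplying out the product over \<open>D\<close> picks one character for each prime.
  Each choice function \<open>j\<close> leaves a single character, hence one line sum.\<close>

lemma sieve_sum_part_eq:
  assumes "finite D"
  shows "sieve_sum_part i D = (\<Prod>p\<in>D. - 1 / of_nat (p - 1)) * (\<Sum>j\<in>PiE D (\<lambda>p. {1..<p}). line_sum (expo i j D))"
proof -
  have "chi (i * (N div 4)) (point \<alpha>) * (\<Prod>p\<in>D. nonpow p (point \<alpha>)) =
      (\<Prod>p\<in>D. - 1 / of_nat (p - 1)) * (\<Sum>j\<in>PiE D (\<lambda>p. {1..<p}). chi (expo i j D) (point \<alpha>))"
    if "\<alpha> \<in> K" for \<alpha>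
  proof -
    let ?x = "point \<alpha>"
    have "(\<Prod>p\<in>D. nonpow p ?x) = (\<Prod>p\<in>D. (- 1 / of_nat (p - 1)) * (\<Sum>j\<in>{1..<p}. chi (j * (N div p)) ?x))"
      by (simp add: nonpow_def)
    also have "\<dots> = (\<Prod>p\<in>D. - 1 / of_nat (p - 1)) * (\<Prod>p\<in>D. \<Sum>j\<in>{1..<p}. chi (j * (N div p)) ?x)"
      by (rule prod.distrib)
    also have "(\<Prod>p\<in>D. \<Sum>j\<in>{1..<p}. chi (j * (N div p)) ?x) =
        (\<Sum>j\<in>PiE D (\<lambda>p. {1..<p}). \<Prod>p\<in>D. chi (j p * (N div p)) ?x)"
      by (rule prod_sum_PiE) (auto simp: assms)
    also have "\<dots> = (\<Sum>j\<in>PiE D (\<lambda>p. {1..<p}). chi (\<Sum>p\<in>D. j p * (N div p)) ?x)"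
      using that assms by (simp add: chi_sum point_nonzero)
    finally show ?thesis
      by (simp add: expo_def chi_add sum_distrib_left mult_ac)
  qed
  then have "sieve_sum_part i D = (\<Sum>\<alpha>\<in>K. (\<Prod>p\<in>D. - 1 / of_nat (p - 1)) *
      (\<Sum>j\<in>PiE D (\<lambda>p. {1..<p}). chi (expo i j D) (point \<alpha>)))"
    unfolding sieve_sum_part_def by (intro sum.cong) auto
  then show ?thesis
    unfolding line_sum_def by (simp add: sum_distrib_left [symmetric]) (subst sum.swap, simp)
qed

text \<open>Up to sign the prefactor is the reciprocal of the number of choice functions. The part
  is thus an average of line sums, and a uniform bound for these carries over.\<close>

lemma norm_sieve_sum_part_le:
  assumes D: "D \<subseteq> odd_prime_divisors"
    and B: "\<And>j. j \<in> PiE D (\<lambda>p. {1..<p}) \<Longrightarrow> cmod (line_sum (expo i j D)) \<le> B"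
  shows "cmod (sieve_sum_part i D) \<le> B"
proof -
  have fin: "finite D" using D finite_odd_prime_divisors by (rule finite_subset)
  let ?J = "PiE D (\<lambda>p. {1..<p})"
  have "cmod (\<Prod>p\<in>D. - 1 / of_nat (p - 1)) = (\<Prod>p\<in>D. 1 / real (p - 1))"
    by (simp add: prod_norm [symmetric] norm_divide del: of_nat_diff)
  moreover have "cmod (\<Sum>j\<in>?J. line_sum (expo i j D)) \<le> real (card ?J) * B"
    by (rule sum_norm_bound) (rule B)
  moreover have "real (card ?J) = (\<Prod>p\<in>D. real (p - 1))"
    using fin by (simp add: card_PiE del: of_nat_diff)
  ultimately have "cmod (sieve_sum_part i D) \<le> (\<Prod>p\<in>D. 1 / real (p - 1)) * ((\<Prod>p\<in>D. real (p - 1)) * B)"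
    unfolding sieve_sum_part_eq [OF fin] norm_mult
    using mult_left_mono [of "cmod (\<Sum>j\<in>?J. line_sum (expo i j D))" "real (card ?J) * B"
        "\<Prod>p\<in>D. 1 / real (p - 1)"]
    by (simp add: prod_nonneg del: of_nat_diff)
  also have "\<dots> = (\<Prod>p\<in>D. 1 / real (p - 1) * real (p - 1)) * B"
    by (simp only: prod.distrib mult.assoc)
  also have "(\<Prod>p\<in>D. 1 / real (p - 1) * real (p - 1)) = 1"
  proof (rule prod.neutral, rule ballI)
    fix p assume "p \<in> D"
    then have "p > 1" using D prime_gt_1_nat by (auto simp: odd_prime_divisors_def)
    then show "1 / real (p - 1) * real (p - 1) = 1" by simp
  qed
  finally show ?thesis by simp
qed

text \<open>The value 1 belongs to those \<open>i\<close> for which the character of order dividing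
  4 is trivial on the units of \<open>K\<close>.\<close>

definition part_bound :: "nat \<Rightarrow> real" where
  "part_bound i = (if 4 dvd (q + 1) * i then 1 else sqrt (real q))"

lemma sqrt_q_ge_1: "1 \<le> sqrt (real q)"
  using q_ge_3 by simp

text \<open>For \<open>i < 4\<close> the second assumption excludes only the trivial character,
  whose line sum is \<open>q\<close>.\<close>

lemma norm_sieve_sum_part_le_cases:
  assumes D: "D \<subseteq> odd_prime_divisors" and nontriv: "D \<noteq> {} \<or> 0 < i \<and> i < 4"
  shows "cmod (sieve_sum_part i D) \<le> sqrt (real q)"
    and "\<forall>p\<in>D. p dvd q + 1 \<Longrightarrow> cmod (sieve_sum_part i D) \<le> part_bound i"
proof -
  have nd: "\<not> N dvd expo i j D" if j: "j \<in> PiE D (\<lambda>p. {1..<p})" for j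
  proof (cases "D = {}")
    case True
    then show ?thesis using nontriv not_dvd_expo_empty by blast
  next
    case False
    then obtain r where r: "r \<in> D" by blast
    then have "\<not> r dvd 1" using D by (auto simp: odd_prime_divisors_def)
    from not_dvd_expo [OF D r j this] show ?thesis by simp
  qed
  show "cmod (sieve_sum_part i D) \<le> sqrt (real q)"
    by (rule norm_sieve_sum_part_le [OF D]) (use nd sqrt_q_ge_1 in \<open>simp add: norm_line_sum\<close>)
  assume "\<forall>p\<in>D. p dvd q + 1"
  then show "cmod (sieve_sum_part i D) \<le> part_bound i"
    using dvd_expo [OF D] nd sqrt_q_ge_1 by (intro norm_sieve_sum_part_le [OF D]) (auto simp: norm_line_sum part_bound_def)
qed

definition small_bound :: real where "small_bound = (\<Sum>i<4. part_bound i)"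

definition sieve_bound :: "nat set \<Rightarrow> real" where
  "sieve_bound D = (if \<forall>p\<in>D. p dvd q + 1 then small_bound else 4 * sqrt (real q))"

lemma norm_sieve_sum_le: "cmod (sieve_sum D) \<le> (\<Sum>i<4. cmod (sieve_sum_part i D))"
  unfolding sieve_sum_eq_sum_sieve_sum_part by (rule order_trans [OF norm_sum]) (simp add: norm_mult norm_power)

lemma Re_sieve_sum_ge:
  assumes "D \<subseteq> odd_prime_divisors" "D \<noteq> {}"
  shows "Re (sieve_sum D) \<ge> - sieve_bound D"
proof -
  have "(\<Sum>i<4. cmod (sieve_sum_part i D)) \<le> sieve_bound D"
  proof (cases "\<forall>p\<in>D. p dvd q + 1")
    case True
    then show ?thesis
      unfolding sieve_bound_def small_bound_def using assms by (auto intro!: sum_mono norm_sieve_sum_part_le_cases(2))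
  next
    case False
    have "(\<Sum>i<4::nat. cmod (sieve_sum_part i D)) \<le> (\<Sum>i<4::nat. sqrt (real q))"
      using assms by (intro sum_mono norm_sieve_sum_part_le_cases(1)) auto
    with False show ?thesis by (auto simp: sieve_bound_def)
  qed
  then have "cmod (sieve_sum D) \<le> sieve_bound D" using norm_sieve_sum_le by (rule order_trans [rotated])
  then show ?thesis using abs_Re_le_cmod [of "sieve_sum D"] by linarith
qed

text \<open>The trivial character \<open>i = 0\<close> contributes exactly \<open>q\<close>. Only
  the other three are estimated, so of \<open>small_bound\<close> the summand
  \<open>part_bound 0 = 1\<close> is given back.\<close>

lemma Re_sieve_sum_empty_ge: "Re (sieve_sum {}) \<ge> real q + 1 - small_bound"
proof -
  have T0: "sieve_sum_part 0 {} = of_nat q"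
    using line_sum_0 by (simp add: sieve_sum_part_def line_sum_def)
  have split: "(\<Sum>i<4. h i) = h 0 + (\<Sum>i\<in>{1..<4}. h i)" for h :: "nat \<Rightarrow> 'b::comm_monoid_add"
    by (simp add: lessThan_atLeast0 sum.atLeast_Suc_lessThan)
  have "sieve_sum {} = of_nat q + (\<Sum>i\<in>{1..<4}. (-1) ^ i * sieve_sum_part i {})"
    unfolding sieve_sum_eq_sum_sieve_sum_part split by (simp add: T0)
  moreover have "cmod (\<Sum>i\<in>{1..<4}. (-1) ^ i * sieve_sum_part i {}) \<le> (\<Sum>i\<in>{1..<4}. part_bound i)"
  proof (rule sum_norm_le)
    fix i :: nat assume "i \<in> {1..<4}"
    then show "cmod ((-1) ^ i * sieve_sum_part i {}) \<le> part_bound i"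
      using norm_sieve_sum_part_le_cases(2) [of "{}" i] by (simp add: norm_mult norm_power)
  qed
  moreover have "small_bound = 1 + (\<Sum>i\<in>{1..<4}. part_bound i)"
    unfolding small_bound_def split by (simp add: part_bound_def)
  ultimately show ?thesis
    using abs_Re_le_cmod [of "\<Sum>i\<in>{1..<4}. (-1) ^ i * sieve_sum_part i {}"] by simp
qed

section \<open>The exact count as a sum over sets of primes\<close>

definition good :: "nat set \<Rightarrow> 'a set" where
  "good P = {\<alpha> \<in> K. (\<forall>p\<in>P. \<not> is_nonzero_power p (point \<alpha>)) \<and>
     is_nonzero_power 2 (point \<alpha>) \<and> \<not> is_nonzero_power 4 (point \<alpha>)}"

lemma prod_of_bool: "finite A \<Longrightarrow> (\<Prod>x\<in>A. of_bool (h x)) = (of_bool (\<forall>x\<in>A. h x) :: complex)"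
  by (induction A rule: finite_induct) auto

text \<open>Multiply the indicators for all primes of \<open>P\<close> with \<open>sqpart\<close>
  and expand the product of the factors \<open>1 + nonpow p\<close> over the subsets of
  \<open>P\<close>.\<close>

lemma card_good:
  assumes "P \<subseteq> odd_prime_divisors"
  shows "4 * real (card (good P)) = (\<Prod>p\<in>P. 1 - 1 / real p) * (\<Sum>D\<in>Pow P. Re (sieve_sum D))"
proof -
  have fin: "finite P" using assms finite_odd_prime_divisors by (rule finite_subset)
  have ind: "4 * of_bool (\<alpha> \<in> good P) = sqpart (point \<alpha>) * (of_real (\<Prod>p\<in>P. 1 - 1 / real p) *
      (\<Sum>D\<in>Pow P. \<Prod>p\<in>D. nonpow p (point \<alpha>)))" if \<alpha>: "\<alpha> \<in> K" for \<alpha>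
  proof -
    let ?x = "point \<alpha>"
    have x: "?x \<noteq> 0" using \<alpha> by (rule point_nonzero)
    have "(\<Prod>p\<in>P. of_real (1 - 1 / real p) * (1 + nonpow p ?x)) =
        (\<Prod>p\<in>P. of_bool (\<not> is_nonzero_power p ?x))"
      using assms x by (intro prod.cong refl nonpower_indicator) (auto simp: odd_prime_divisors_def)
    also have "\<dots> = of_bool (\<forall>p\<in>P. \<not> is_nonzero_power p ?x)"
      using fin by (rule prod_of_bool)
    finally have "of_bool (\<forall>p\<in>P. \<not> is_nonzero_power p ?x) =
        of_real (\<Prod>p\<in>P. 1 - 1 / real p) * (\<Prod>p\<in>P. nonpow p ?x + 1)"
      by (simp only: prod.distrib of_real_prod add.commute)
    also have "(\<Prod>p\<in>P. nonpow p ?x + 1) = (\<Sum>D\<in>Pow P. \<Prod>p\<in>D. nonpow p ?x)"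
      using fin by (simp add: prod_add)
    finally have *: "of_real (\<Prod>p\<in>P. 1 - 1 / real p) * (\<Sum>D\<in>Pow P. \<Prod>p\<in>D. nonpow p ?x) =
        of_bool (\<forall>p\<in>P. \<not> is_nonzero_power p ?x)" by (rule sym)
    show ?thesis
      unfolding * using \<alpha> square_nonquartic_indicator [OF four_dvd_N x] by (auto simp: good_def)
  qed
  have "complex_of_real (4 * real (card (good P))) = (\<Sum>\<alpha>\<in>K. 4 * of_bool (\<alpha> \<in> good P))"
  proof -
    have "(\<Sum>\<alpha>\<in>K. of_bool (\<alpha> \<in> good P)) = (of_nat (card (K \<inter> good P)) :: complex)"
      by (simp add: sum_of_bool_eq Int_def)
    moreover have "K \<inter> good P = good P" by (auto simp: good_def)
    ultimately show ?thesis by (simp flip: sum_distrib_left)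
  qed
  also have "\<dots> = (\<Sum>\<alpha>\<in>K. sqpart (point \<alpha>) * (of_real (\<Prod>p\<in>P. 1 - 1 / real p) *
      (\<Sum>D\<in>Pow P. \<Prod>p\<in>D. nonpow p (point \<alpha>))))"
    by (intro sum.cong refl ind)
  also have "\<dots> = of_real (\<Prod>p\<in>P. 1 - 1 / real p) * (\<Sum>D\<in>Pow P. sieve_sum D)"
    unfolding sieve_sum_def sum_distrib_left by (subst sum.swap) (simp only: mult_ac)
  \<comment> \<open>The count is real, so real parts of the sums suffice.\<close>
  finally have "Re (complex_of_real (4 * real (card (good P)))) =
      Re (of_real (\<Prod>p\<in>P. 1 - 1 / real p) * (\<Sum>D\<in>Pow P. sieve_sum D))" by simp
  then show ?thesis by (simp add: Re_sum del: of_real_prod)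
qed

subsection \<open>The prime sieve\<close>

text \<open>Charge \<open>4 * sqrt q\<close> to every subset, then refund the saving for the sets
  \<open>D\<close> whose primes all divide \<open>q + 1\<close>. A prime of \<open>E\<close> not
  dividing \<open>q + 1\<close> rules out every refund.\<close>

lemma sum_sieve_bound:
  assumes "finite P"
  shows "(\<Sum>D\<in>Pow P. sieve_bound (D \<union> E)) = 4 * 2 ^ card P * sqrt (real q) -
    (if \<forall>p\<in>E. p dvd q + 1 then 2 ^ card {p \<in> P. p dvd q + 1} * (4 * sqrt (real q) - small_bound) else 0)"
proof (cases "\<forall>p\<in>E. p dvd q + 1")
  case True
  let ?P1 = "{p \<in> P. p dvd q + 1}"
  have "sieve_bound (D \<union> E) = 4 * sqrt (real q) - of_bool (D \<in> Pow ?P1) * (4 * sqrt (real q) - small_bound)" if "D \<in> Pow P" for D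
    using that True by (auto simp: sieve_bound_def)
  then have "(\<Sum>D\<in>Pow P. sieve_bound (D \<union> E)) =
      (\<Sum>D\<in>Pow P. 4 * sqrt (real q) - of_bool (D \<in> Pow ?P1) * (4 * sqrt (real q) - small_bound))"
    by (rule sum.cong [OF refl])
  also have "\<dots> = 4 * 2 ^ card P * sqrt (real q) - (\<Sum>D\<in>Pow P. of_bool (D \<in> Pow ?P1)) * (4 * sqrt (real q) - small_bound)"
    using assms by (simp add: sum_subtractf sum_distrib_right card_Pow)
  also have "(\<Sum>D\<in>Pow P. of_bool (D \<in> Pow ?P1)) = real (card (Pow P \<inter> Pow ?P1))"
    using assms by (simp add: sum_of_bool_eq Int_def del: Pow_iff)
  also have "Pow P \<inter> Pow ?P1 = Pow ?P1" by auto
  also have "real (card (Pow ?P1)) = 2 ^ card ?P1"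
    using assms by (simp add: card_Pow)
  finally show ?thesis using True by simp
next
  case False
  then have "sieve_bound (D \<union> E) = 4 * sqrt (real q)" for D by (auto simp: sieve_bound_def)
  then show ?thesis unfolding if_not_P [OF False] using assms by (simp add: card_Pow)
qed

text \<open>An element of \<open>good P\<close> outside \<open>good (P \<union> R)\<close> is
  already lost on adding some single prime of \<open>R\<close>.\<close>

lemma card_good_union_ge:
  assumes "finite R"
  shows "real (card (good (P \<union> R))) \<ge>
    real (card (good P)) - (\<Sum>p\<in>R. real (card (good P)) - real (card (good (insert p P))))"
proof -
  have sub: "good (insert p P) \<subseteq> good P" for p by (auto simp: good_def)
  have "good P \<subseteq> good (P \<union> R) \<union> (\<Union>p\<in>R. good P - good (insert p P))"
    by (auto simp: good_def)
  then have "card (good P) \<le> card (good (P \<union> R) \<union> (\<Union>p\<in>R. good P - good (insert p P)))"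
    by (intro card_mono) auto
  also have "\<dots> \<le> card (good (P \<union> R)) + (\<Sum>p\<in>R. card (good P - good (insert p P)))"
    by (rule order_trans [OF card_Un_le]) (rule add_left_mono [OF card_UN_le [OF assms]])
  finally have "real (card (good P)) \<le> real (card (good (P \<union> R)) + (\<Sum>p\<in>R. card (good P - good (insert p P))))"
    by (rule of_nat_mono)
  moreover have "real (card (good P - good (insert p P))) = real (card (good P)) - real (card (good (insert p P)))" for p
    using card_mono [OF _ sub [of p]] by (simp add: card_Diff_subset [OF _ sub] of_nat_diff)
  ultimately show ?thesis by simp
qed

text \<open>Here \<open>A - C\<close> is the total of \<open>sieve_bound\<close> over the subsets of
  \<open>P\<close>, with \<open>C\<close> the refund. The union bound is linear in the sums
  \<open>X\<close> over subsets of \<open>P\<close> and \<open>Y p\<close> over these subsets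
  enlarged by \<open>p\<close>; \<open>ineq\<close> makes it positive once both are replaced by
  their lower bounds.\<close>

lemma good_nonempty:
  fixes P R defines "A \<equiv> 4 * 2 ^ card P * sqrt (real q)"
    and "C \<equiv> 2 ^ card {p \<in> P. p dvd q + 1} * (4 * sqrt (real q) - small_bound)"
  assumes PR: "P \<subseteq> odd_prime_divisors" "R \<subseteq> odd_prime_divisors" "P \<inter> R = {}"
    and \<epsilon>: "1 - (\<Sum>p\<in>R. 1 / real p) > 0"
    and ineq: "(1 - (\<Sum>p\<in>R. 1 / real p)) * (real q + 1 - A + C) >
      (\<Sum>p\<in>R. 1 - 1 / real p) * A - (\<Sum>p\<in>{p\<in>R. p dvd q + 1}. 1 - 1 / real p) * C"
  shows "good (P \<union> R) \<noteq> {}"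
proof -
  have finP: "finite P" using PR(1) finite_odd_prime_divisors by (rule finite_subset)
  have finR: "finite R" using PR(2) finite_odd_prime_divisors by (rule finite_subset)
  define \<delta> where "\<delta> = (\<Prod>p\<in>P. 1 - 1 / real p)"
  define X where "X = (\<Sum>D\<in>Pow P. Re (sieve_sum D))"
  define Y where "Y = (\<lambda>p. \<Sum>D\<in>Pow P. Re (sieve_sum (insert p D)))"
  define \<epsilon> where "\<epsilon> = 1 - (\<Sum>p\<in>R. 1 / real p)"
  have gt1: "real p > 1" if "p \<in> odd_prime_divisors" for p
    using that prime_gt_1_nat [of p] by (auto simp: odd_prime_divisors_def)
  have "\<delta> > 0" unfolding \<delta>_def using PR(1) gt1 by (intro prod_pos) (fastforce simp: field_simps)
  have gP: "4 * real (card (good P)) = \<delta> * X"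
    unfolding \<delta>_def X_def using PR(1) by (rule card_good)
  have gp: "4 * real (card (good (insert p P))) = \<delta> * ((1 - 1 / real p) * (X + Y p))" if p: "p \<in> R" for p
  proof -
    have pP: "p \<notin> P" using p PR(3) by auto
    have "insert p P \<subseteq> odd_prime_divisors" using p PR by auto
    then have "4 * real (card (good (insert p P))) =
        (\<Prod>p\<in>insert p P. 1 - 1 / real p) * (\<Sum>D\<in>Pow (insert p P). Re (sieve_sum D))"
      by (rule card_good)
    also have "(\<Prod>p\<in>insert p P. 1 - 1 / real p) = (1 - 1 / real p) * \<delta>"
      using pP finP by (simp add: \<delta>_def)
    also have "(\<Sum>D\<in>Pow (insert p P). Re (sieve_sum D)) = X + (\<Sum>D\<in>insert p ` Pow P. Re (sieve_sum D))"
      unfolding Pow_insert X_def using finP pP by (subst sum.union_disjoint) auto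
    also have "(\<Sum>D\<in>insert p ` Pow P. Re (sieve_sum D)) = Y p"
      unfolding Y_def using pP by (subst sum.reindex) (auto simp: inj_on_def)
    finally show ?thesis by (simp only: mult_ac)
  qed
  \<comment> \<open>The empty set supplies the main term; its \<open>sieve_bound\<close> is
    \<open>small_bound\<close>, so all errors together amount to \<open>A - C\<close>.\<close>
  have X_ge: "X \<ge> real q + 1 - A + C"
  proof -
    have "Pow P = insert {} (Pow P - {{}})" by auto
    then have split: "(\<Sum>D\<in>Pow P. h D) = h {} + (\<Sum>D\<in>Pow P - {{}}. h D)" for h :: "nat set \<Rightarrow> real"
      using finP by (subst sum.remove [of _ "{}"]) auto
    have "(\<Sum>D\<in>Pow P - {{}}. Re (sieve_sum D)) \<ge> (\<Sum>D\<in>Pow P - {{}}. - sieve_bound D)"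
      using PR(1) by (intro sum_mono Re_sieve_sum_ge) auto
    then have "X \<ge> real q + 1 - small_bound + (\<Sum>D\<in>Pow P - {{}}. - sieve_bound D)"
      unfolding X_def split using Re_sieve_sum_empty_ge by linarith
    moreover have "(\<Sum>D\<in>Pow P. sieve_bound D) = small_bound + (\<Sum>D\<in>Pow P - {{}}. sieve_bound D)"
      unfolding split by (simp add: sieve_bound_def)
    moreover have "(\<Sum>D\<in>Pow P. sieve_bound D) = A - C"
      using sum_sieve_bound [OF finP, of "{}"] by (simp add: A_def C_def)
    ultimately show ?thesis by (simp add: sum_negf)
  qed
  \<comment> \<open>Every set here contains \<open>p\<close>, so there is no main term, and a refund
    occurs only if \<open>p\<close> divides \<open>q + 1\<close>.\<close>
  have Y_ge: "Y p \<ge> (if p dvd q + 1 then C else 0) - A" if p: "p \<in> R" for p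
  proof -
    have "Y p \<ge> (\<Sum>D\<in>Pow P. - sieve_bound (insert p D))"
      unfolding Y_def using PR p by (intro sum_mono Re_sieve_sum_ge) auto
    moreover have "(\<Sum>D\<in>Pow P. sieve_bound (insert p D)) = A - (if p dvd q + 1 then C else 0)"
      using sum_sieve_bound [OF finP, of "{p}"] by (simp add: A_def C_def)
    ultimately show ?thesis by (simp add: sum_negf)
  qed
  have "4 * (real (card (good P)) - (\<Sum>p\<in>R. real (card (good P)) - real (card (good (insert p P))))) =
      \<delta> * X - (\<Sum>p\<in>R. \<delta> * X - \<delta> * ((1 - 1 / real p) * (X + Y p)))"
    using gP gp by (simp add: sum_distrib_left right_diff_distrib)
  also have "\<dots> = \<delta> * (X - (\<Sum>p\<in>R. X * (1 / real p) - (1 - 1 / real p) * Y p))"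
  proof -
    \<comment> \<open>Rewriting the loss \<open>X - (1 - 1/p) * (X + Y p)\<close> as
      \<open>X / p - (1 - 1/p) * Y p\<close> lets the multiples of \<open>X\<close> add up to
      \<open>\<epsilon> * X\<close>.\<close>
    have "\<delta> * X - \<delta> * ((1 - 1 / real p) * (X + Y p)) =
        \<delta> * (X * (1 / real p) - (1 - 1 / real p) * Y p)" for p
      by (simp add: algebra_simps add_divide_distrib)
    then show ?thesis by (simp only: sum_distrib_left [symmetric] right_diff_distrib [symmetric])
  qed
  also have "(\<Sum>p\<in>R. X * (1 / real p) - (1 - 1 / real p) * Y p) =
      X * (\<Sum>p\<in>R. 1 / real p) - (\<Sum>p\<in>R. (1 - 1 / real p) * Y p)"
    by (simp only: sum_subtractf sum_distrib_left)
  also have "X - (X * (\<Sum>p\<in>R. 1 / real p) - (\<Sum>p\<in>R. (1 - 1 / real p) * Y p)) =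
      \<epsilon> * X + (\<Sum>p\<in>R. (1 - 1 / real p) * Y p)"
    by (simp add: \<epsilon>_def algebra_simps)
  finally have eq: "4 * (real (card (good P)) - (\<Sum>p\<in>R. real (card (good P)) - real (card (good (insert p P))))) =
      \<delta> * (\<epsilon> * X + (\<Sum>p\<in>R. (1 - 1 / real p) * Y p))" .
  have "(\<Sum>p\<in>R. (1 - 1 / real p) * Y p) \<ge>
      (\<Sum>p\<in>R. (1 - 1 / real p) * ((if p dvd q + 1 then C else 0) - A))"
    using PR(2) gt1 by (intro sum_mono mult_left_mono Y_ge) (fastforce simp: field_simps)+
  also have "(\<Sum>p\<in>R. (1 - 1 / real p) * ((if p dvd q + 1 then C else 0) - A)) =
      (\<Sum>p\<in>R. if p dvd q + 1 then (1 - 1 / real p) * C else 0) - (\<Sum>p\<in>R. (1 - 1 / real p) * A)"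
    unfolding sum_subtractf [symmetric] by (rule sum.cong) (auto simp: right_diff_distrib)
  also have "(\<Sum>p\<in>R. if p dvd q + 1 then (1 - 1 / real p) * C else 0) =
      (\<Sum>p\<in>{p\<in>R. p dvd q + 1}. 1 - 1 / real p) * C"
    unfolding sum_distrib_right using finR by (simp only: sum.inter_filter)
  also have "(\<Sum>p\<in>R. (1 - 1 / real p) * A) = (\<Sum>p\<in>R. 1 - 1 / real p) * A"
    by (rule sum_distrib_right [symmetric])
  finally have "(\<Sum>p\<in>R. (1 - 1 / real p) * Y p) \<ge>
      (\<Sum>p\<in>{p\<in>R. p dvd q + 1}. 1 - 1 / real p) * C - (\<Sum>p\<in>R. 1 - 1 / real p) * A" .
  moreover have "\<epsilon> * X \<ge> \<epsilon> * (real q + 1 - A + C)"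
    using \<epsilon> X_ge by (intro mult_left_mono) (auto simp: \<epsilon>_def)
  ultimately have "\<epsilon> * X + (\<Sum>p\<in>R. (1 - 1 / real p) * Y p) > 0"
    using ineq unfolding \<epsilon>_def by linarith
  then have "real (card (good (P \<union> R))) > 0"
    using card_good_union_ge [OF finR, of P] eq \<open>\<delta> > 0\<close> by (smt (verit) mult_pos_pos)
  then show ?thesis by auto
qed

text \<open>If \<open>q\<close> is 1 modulo 4, then \<open>q + 1\<close> is 2 modulo 4 and only
  \<open>i = 0\<close> and \<open>i = 2\<close> have bound 1. If \<open>q\<close> is 3 modulo 4, all
  four have.\<close>

lemma small_bound_eq:
  shows "[q = 1] (mod 4) \<Longrightarrow> small_bound = 2 + 2 * sqrt (real q)"
    and "[q = 3] (mod 4) \<Longrightarrow> small_bound = 4"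
proof -
  have small_bound: "small_bound = part_bound 0 + part_bound 1 + part_bound 2 + part_bound 3"
    by (simp add: small_bound_def eval_nat_numeral)
  show "small_bound = 2 + 2 * sqrt (real q)" if "[q = 1] (mod 4)"
  proof -
    have "\<not> 4 dvd q + 1" "4 dvd (q + 1) * 2" "\<not> 4 dvd (q + 1) * 3"
      using that unfolding cong_def by presburger+
    then show ?thesis by (simp add: small_bound part_bound_def)
  qed
  show "small_bound = 4" if "[q = 3] (mod 4)"
  proof -
    have "4 dvd q + 1" using that unfolding cong_def by presburger
    then have "part_bound i = 1" for i unfolding part_bound_def by (simp only: dvd_mult2 if_True)
    then show ?thesis by (simp add: small_bound)
  qed
qed

end

section \<open>Square-free divisors and freeness\<close>

lemma prime_factors_Prod:
  assumes "finite X" "\<And>p. p \<in> X \<Longrightarrow> prime (p::nat)"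
  shows "prime_factors (\<Prod>X) = X"
proof -
  have "\<Prod>X \<noteq> 0" using assms by (metis not_prime_0 prod_zero_iff)
  moreover have "prime p \<and> p dvd \<Prod>X \<longleftrightarrow> p \<in> X" for p
    using assms by (auto simp: prime_dvd_prod_iff) (metis primes_dvd_imp_eq)
  ultimately show ?thesis by (auto simp: prime_factors_dvd)
qed

lemma squarefree_Prod_primes:
  assumes "\<And>p. p \<in> X \<Longrightarrow> prime (p::nat)"
  shows "squarefree (\<Prod>X)"
  using assms by (intro squarefree_prod_coprime) (auto simp: squarefree_prime primes_coprime)

lemma Prod_prime_factors:
  assumes "squarefree (d::nat)"
  shows "\<Prod>(prime_factors d) = d"
proof -
  have d: "d \<noteq> 0" using assms by (metis not_squarefree_0)
  have "d = (\<Prod>p\<in>prime_factors d. p ^ multiplicity p d)"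
    using d by (intro prime_factorization_nat) simp
  also have "\<dots> = \<Prod>(prime_factors d)"
    using assms d by (intro prod.cong) (auto simp: squarefree_factorial_semiring')
  finally show ?thesis by simp
qed

lemma Prod_prime_factors_dvd:
  assumes "n > 0" "X \<subseteq> prime_factors (n::nat)"
  shows "\<Prod>X dvd n"
proof -
  have "\<Prod>X dvd \<Prod>(prime_factors n)" using assms by (intro prod_dvd_prod_subset) auto
  also have "\<dots> dvd (\<Prod>p\<in>prime_factors n. p ^ multiplicity p n)"
    using assms by (intro prod_dvd_prod) (auto simp: prime_factors_multiplicity)
  also have "\<dots> = n" using assms by (simp add: prime_factorization_nat [symmetric])
  finally show ?thesis .
qed

text \<open>Square-free divisors correspond to sets of prime divisors, by taking products in one
  direction and prime factors in the other.\<close>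

lemma W_eq_power:
  assumes "n > 0"
  shows "W n = 2 ^ card (prime_factors n)"
proof -
  have "bij_betw Prod (Pow (prime_factors n)) {d. d dvd n \<and> squarefree d}"
  proof (rule bij_betw_byWitness [where f' = prime_factors])
    have *: "finite X" "\<And>p. p \<in> X \<Longrightarrow> prime p" if "X \<in> Pow (prime_factors n)" for X
      using that finite_subset [of X "prime_factors n"] by auto
    show "\<forall>X\<in>Pow (prime_factors n). prime_factors (\<Prod>X) = X"
      using * by (intro ballI prime_factors_Prod)
    show "\<forall>d\<in>{d. d dvd n \<and> squarefree d}. \<Prod>(prime_factors d) = d"
      by (auto simp: Prod_prime_factors)
    show "Prod ` Pow (prime_factors n) \<subseteq> {d. d dvd n \<and> squarefree d}"
      using * assms by (auto intro!: Prod_prime_factors_dvd squarefree_Prod_primes)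
    show "prime_factors ` {d. d dvd n \<and> squarefree d} \<subseteq> Pow (prime_factors n)"
      using assms dvd_prime_factors [of n] by auto
  qed
  then show ?thesis
    unfolding W_def by (simp add: bij_betw_same_card [symmetric] card_Pow)
qed

text \<open>Identifies \<open>k1\<close> with a greatest common divisor, whose prime factors can be
  read off.\<close>

lemma Max_common_divisor:
  fixes k m :: nat
  assumes "m > 0"
  shows "Max {d. d dvd k \<and> d dvd m} = gcd k m"
proof (rule Max_eqI)
  show "finite {d. d dvd k \<and> d dvd m}"
    by (rule finite_subset [of _ "{..m}"]) (use assms in \<open>auto dest: dvd_imp_le\<close>)
  show "d \<le> gcd k m" if "d \<in> {d. d dvd k \<and> d dvd m}" for d
    using that assms by (intro dvd_imp_le) auto
qed simp

text \<open>A \<open>d\<close>-th power with \<open>d \<noteq> 1\<close> is a \<open>p\<close>-th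
  power for every prime \<open>p\<close> dividing \<open>d\<close>, so prime exponents
  suffice.\<close>

lemma t_free_iff:
  fixes x :: "'a::field"
  assumes "t > 0" "x \<noteq> 0"
  shows "t_free t x \<longleftrightarrow> (\<forall>p\<in>prime_factors t. \<not> is_nonzero_power p x)"
proof
  assume "t_free t x"
  then have "p = 1" if "p dvd t" "is_nonzero_power p x" for p
    using that by (auto simp: t_free_def is_nonzero_power_def)
  then show "\<forall>p\<in>prime_factors t. \<not> is_nonzero_power p x"
    by (metis in_prime_factors_iff not_prime_1)
next
  assume *: "\<forall>p\<in>prime_factors t. \<not> is_nonzero_power p x"
  have "d = 1" if d: "d dvd t" "\<zeta> \<noteq> 0" "x = \<zeta> ^ d" for d \<zeta>
  proof (rule ccontr)
    assume "d \<noteq> 1"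
    then obtain p where p: "prime p" "p dvd d" using prime_factor_nat by blast
    then have "x = (\<zeta> ^ (d div p)) ^ p" using d by (simp flip: power_mult)
    then have "is_nonzero_power p x"
      using d(2) by (auto simp: is_nonzero_power_def intro!: exI [of _ "\<zeta> ^ (d div p)"])
    moreover have "p \<in> prime_factors t"
      using p d(1) assms(1) by (auto simp: prime_factors_dvd intro: dvd_trans)
    ultimately show False using * by blast
  qed
  then show "t_free t x" using assms(2) by (auto simp: t_free_def)
qed

section \<open>Translation of the hypotheses into the sieve inequality\<close>

theorem theorem6p7:
  fixes q k k1 r s :: nat
    and K :: "'a::{field,finite} set"
    and \<beta> \<theta>1 \<theta>2 :: 'a
    and p :: "nat \<Rightarrow> nat"
    and \<epsilon> \<epsilon>' :: real
  assumes "primepow q" and "odd q"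
    and "CARD('a) = q\<^sup>2"
    and "is_subfield K" and "card K = q"
    and "\<beta> \<in> K" and "\<beta> \<noteq> 0"
    and "is_basis2 K \<theta>1 \<theta>2"
    and "Tr q \<theta>1 = \<beta>" and "Tr q \<theta>2 = 0"
    and "odd_radical (q\<^sup>2 - 1) = k * (\<Prod>i=1..s. p i)"
    and "\<forall>i\<in>{1..s}. prime (p i) \<and> \<not> p i dvd k"
    and "inj_on p {1..s}"
    and "r \<le> s"
    and "\<forall>i\<in>{1..r}. p i dvd q + 1"
    and "\<forall>i\<in>{r<..s}. \<not> p i dvd q + 1"
    and "\<epsilon> = 1 - (\<Sum>i=1..s. 1 / real (p i))"
    and "\<epsilon>' = 1 - (\<Sum>i=1..r. 1 / real (p i))"
    and "k1 = Max {d. d dvd k \<and> d dvd q + 1}"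
    and "\<epsilon> > 0"
  shows "([q = 1] (mod 4) \<and>
          real q + 1 > 4 * (real (W k) * ((real s - 1) / \<epsilon> + 2) * sqrt (real q)
            - real (W k1) * ((real r - 1 + \<epsilon>') / \<epsilon> + 1) * ((sqrt (real q) - 1) / 2))
          \<longrightarrow> Q_count K \<theta>1 \<theta>2 (odd_radical (q\<^sup>2 - 1)) \<noteq> 0) \<and>
         ([q = 3] (mod 4) \<and>
          real q + 1 > 4 * (real (W k) * ((real s - 1) / \<epsilon> + 2) * sqrt (real q)
            - real (W k1) * ((real r - 1 + \<epsilon>') / \<epsilon> + 1) * (sqrt (real q) - 1))
          \<longrightarrow> Q_count K \<theta>1 \<theta>2 (odd_radical (q\<^sup>2 - 1)) \<noteq> 0)"
proof -
  obtain g :: 'a and N where g: "field_generator g N"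
    using ex_field_generator by blast
  interpret field_generator g N by (rule g)
  interpret affine_line g N q K \<theta>1 \<theta>2
    by unfold_locales (use assms(2-5,8) in auto)
  define M where "M = odd_radical (q\<^sup>2 - 1)"
  have M: "M = \<Prod>odd_prime_divisors"
    unfolding M_def odd_radical_def odd_prime_divisors_def by (simp only: N_eq assms(3))
  have prime: "prime l" if "l \<in> odd_prime_divisors" for l
    using that by (simp add: odd_prime_divisors_def)
  have pfM: "prime_factors M = odd_prime_divisors"
    unfolding M using prime by (intro prime_factors_Prod) auto
  have "squarefree M" unfolding M using prime by (intro squarefree_Prod_primes)
  then have "M > 0" by (metis not_squarefree_0 gr0I)
  \<comment> \<open>The primes of \<open>k\<close> are handled exactly by the full expansion; the
    primes in \<open>R\<close> go through the union bound.\<close>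
  define P where "P = prime_factors k"
  define R where "R = p ` {1..s}"
  have M_eq: "M = k * (\<Prod>i=1..s. p i)" using assms(11) by (simp add: M_def)
  then have k: "k > 0" using \<open>M > 0\<close> by (metis gr0I mult_0)
  have prodR: "(\<Prod>i=1..s. p i) = \<Prod>R"
    unfolding R_def using assms(13) by (simp add: prod.reindex)
  have pfR: "prime_factors (\<Prod>R) = R"
    using assms(12) by (intro prime_factors_Prod) (auto simp: R_def)
  have "\<Prod>R \<noteq> 0" using M_eq \<open>M > 0\<close> prodR by (metis mult_0_right less_irrefl)
  then have PR: "P \<union> R = odd_prime_divisors"
    using k pfM pfR unfolding M_eq prodR P_def by (simp add: prime_factorization_mult)
  have disj: "P \<inter> R = {}"
    using assms(12) by (auto simp: P_def R_def prime_factors_dvd)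
  have Wk: "real (W k) = 2 ^ card P" using k by (simp add: W_eq_power P_def)
  have "k1 = gcd k (q + 1)" using assms(19) Max_common_divisor [of "q + 1" k] by simp
  then have "prime_factors k1 = {l \<in> P. l dvd q + 1}" "k1 > 0"
    using k by (auto simp: P_def prime_factors_dvd)
  then have Wk1: "real (W k1) = 2 ^ card {l \<in> P. l dvd q + 1}" by (simp add: W_eq_power)
  have R1: "{l \<in> R. l dvd q + 1} = p ` {1..r}"
  proof
    show "p ` {1..r} \<subseteq> {l \<in> R. l dvd q + 1}"
      using assms(14,15) by (auto simp: R_def)
    show "{l \<in> R. l dvd q + 1} \<subseteq> p ` {1..r}"
    proof clarify
      fix l assume "l \<in> R" "l dvd q + 1"
      then obtain i where i: "i \<in> {1..s}" "l = p i" by (auto simp: R_def)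
      with \<open>l dvd q + 1\<close> assms(16) have "\<not> r < i" by auto
      with i show "l \<in> p ` {1..r}" by auto
    qed
  qed
  have inj_r: "inj_on p {1..r}" using assms(13,14) by (auto intro: inj_on_subset)
  have sumR: "(\<Sum>l\<in>R. 1 / real l) = 1 - \<epsilon>"
    unfolding R_def using assms(13,17) by (simp add: sum.reindex)
  have sumR': "(\<Sum>l\<in>R. 1 - 1 / real l) = real s - 1 + \<epsilon>"
    unfolding R_def using assms(13,17) by (simp add: sum.reindex sum_subtractf card_image)
  have sumR1: "(\<Sum>l\<in>{l \<in> R. l dvd q + 1}. 1 - 1 / real l) = real r - 1 + \<epsilon>'"
    unfolding R1 using inj_r assms(18) by (simp add: sum.reindex sum_subtractf card_image)
  \<comment> \<open>By the prime criterion for freeness, \<open>M\<close>-free means not an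
    \<open>l\<close>-th power for any odd prime \<open>l\<close> dividing \<open>N\<close>.\<close>
  have Q: "Q_count K \<theta>1 \<theta>2 M = card (good (P \<union> R))"
    unfolding Q_count_def good_def point_def [symmetric] PR
    using \<open>M > 0\<close> pfM by (intro arg_cong [where f = card] Collect_cong)
      (auto simp: t_free_iff point_nonzero)
  \<comment> \<open>Both residue classes of \<open>q\<close> at once: \<open>c\<close> is a quarter
    of the saving \<open>4 * sqrt q - small_bound\<close>, namely \<open>(sqrt q - 1) / 2\<close> or
    \<open>sqrt q - 1\<close>.\<close>
  have key: "Q_count K \<theta>1 \<theta>2 M \<noteq> 0"
    if c: "4 * sqrt (real q) - small_bound = 4 * c"
      and ineq: "real q + 1 > 4 * (real (W k) * ((real s - 1) / \<epsilon> + 2) * sqrt (real q)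
            - real (W k1) * ((real r - 1 + \<epsilon>') / \<epsilon> + 1) * c)" for c
  proof -
    define A where "A = 4 * 2 ^ card P * sqrt (real q)"
    define C where "C = 2 ^ card {l \<in> P. l dvd q + 1} * (4 * sqrt (real q) - small_bound)"
    have "real q + 1 > ((real s - 1) / \<epsilon> + 2) * A - ((real r - 1 + \<epsilon>') / \<epsilon> + 1) * C"
      using ineq unfolding A_def C_def c Wk Wk1 by (simp add: algebra_simps)
    \<comment> \<open>Multiplying by \<open>\<epsilon>\<close> clears the denominators. The part
      \<open>\<epsilon> * (A - C)\<close> is then moved to the left as the error in
      \<open>X\<close>; what remains are the weights \<open>1 - 1 / l\<close> summed over
      \<open>R\<close> and over its primes dividing \<open>q + 1\<close>.\<close>
    then have "\<epsilon> * (real q + 1) > \<epsilon> * (((real s - 1) / \<epsilon> + 2) * A - ((real r - 1 + \<epsilon>') / \<epsilon> + 1) * C)"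
      using assms(20) by simp
    also have "\<epsilon> * (((real s - 1) / \<epsilon> + 2) * A - ((real r - 1 + \<epsilon>') / \<epsilon> + 1) * C) =
        (real s - 1 + \<epsilon>) * A - (real r - 1 + \<epsilon>') * C + \<epsilon> * (A - C)"
      using assms(20) by (simp add: field_simps)
    finally have "\<epsilon> * (real q + 1 - A + C) > (real s - 1 + \<epsilon>) * A - (real r - 1 + \<epsilon>') * C"
      by (simp add: algebra_simps)
    \<comment> \<open>The form \<open>1 - (1 - \<epsilon>)\<close> is what \<open>ineq\<close>
      becomes under the rewriting with \<open>sumR\<close>.\<close>
    then have ineq': "(1 - (1 - \<epsilon>)) * (real q + 1 - A + C) > (real s - 1 + \<epsilon>) * A - (real r - 1 + \<epsilon>') * C"
      by simp
    have "good (P \<union> R) \<noteq> {}"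
    proof (rule good_nonempty)
      show "P \<subseteq> odd_prime_divisors" "R \<subseteq> odd_prime_divisors" using PR by auto
      show "0 < 1 - (\<Sum>l\<in>R. 1 / real l)" using assms(20) sumR by simp
    qed (rule disj, use ineq' in \<open>simp only: sumR sumR' sumR1 A_def C_def\<close>)
    then show ?thesis unfolding Q by (simp add: card_eq_0_iff)
  qed
  have "Q_count K \<theta>1 \<theta>2 M \<noteq> 0"
    if "[q = 1] (mod 4)"
      "real q + 1 > 4 * (real (W k) * ((real s - 1) / \<epsilon> + 2) * sqrt (real q)
            - real (W k1) * ((real r - 1 + \<epsilon>') / \<epsilon> + 1) * ((sqrt (real q) - 1) / 2))"
    using that(2) by (rule key [rotated]) (simp add: small_bound_eq(1) [OF that(1)])
  moreover have "Q_count K \<theta>1 \<theta>2 M \<noteq> 0"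
    if "[q = 3] (mod 4)"
      "real q + 1 > 4 * (real (W k) * ((real s - 1) / \<epsilon> + 2) * sqrt (real q)
            - real (W k1) * ((real r - 1 + \<epsilon>') / \<epsilon> + 1) * (sqrt (real q) - 1))"
    using that(2) by (rule key [rotated]) (simp add: small_bound_eq(2) [OF that(1)])
  ultimately show ?thesis unfolding M_def by blast
qed

end
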